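(* Let $X$ be a real normed space, let $C,K\subset X$ be cones such that $(C,K)$ verifies the SSP, and let $(K_n)_{n\in\mathbb N}$ be a closed inner approximating sequence for $K$. Then there exists $n_0\in\mathbb N$ such that $(C,K_n)$ verifies the SSP for every $n\ge n_0$.
   Context: $X$ is a real normed space, $S_X$ its unit sphere, $B_X^\circ$ its open unit ball; $\operatorname{cl},\operatorname{bd},\operatorname{co}$ denote closure, boundary, convex hull. A cone is a nonempty $C\subset X$ with $\alpha C\subset C$ for all $\alpha\ge 0$; cones are assumed nontrivial ($\{0_X\}\subsetneq C\subset X$) unless otherwise stated. $\operatorname{cone}(A):=\{\lambda a:\lambda\ge 0,\ a\in A\}$. SSP: a pair of cones $(C,K)$ verifies the strict separation property (SSP) if $0_X\notin\operatorname{cl}\bigl(\operatorname{co}(C\cap S_X)-\operatorname{co}((\operatorname{bd}K\cap S_X)\cup\{0_X\})\bigr)$. Interior reduction: for a cone $K$ and $\varepsilon>0$, $K^{-\varepsilon}:=K\setminus\bigl(\operatorname{cone}((\operatorname{bd}K\cap S_X)+\varepsilon B_X^\circ)\setminus\{0_X\}\bigr)$. Inner approximating sequence: a sequence $(K_n)$ of cones is an inner approximating sequence for $K$ if (i) $K_n\subset K_{n+1}\subset K$ for every $n\in\mathbb N$, and (ii) for every $\varepsilon>0$ there is $n_\varepsilon\in\mathbb N$ with $K^{-\varepsilon}\subset K_n$ for all $n\ge n_\varepsilon$. It is called closed if in addition each $K_n$ is closed. *)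

theory Defs
  imports "HOL-Analysis.Analysis"
begin

text \<open>
  The library predicate \<^const>\<open>cone\<close> holds of the empty set, so nonemptiness is stated
  separately. The inclusion \<open>C \<subseteq> X\<close> is not required to be strict: the whole space is allowed.
\<close>

definition nontrivial_cone :: "'a::real_normed_vector set \<Rightarrow> bool" where
  "nontrivial_cone C \<longleftrightarrow> C \<noteq> {} \<and> cone C \<and> {0} \<subset> C"

definition cone_gen :: "'a::real_normed_vector set \<Rightarrow> 'a set" where
  "cone_gen A = {c *\<^sub>R a | c a. 0 \<le> c \<and> a \<in> A}"

lemma cone_gen_eq_cone_hull: "cone_gen A = cone hull A"
  by (simp add: cone_gen_def cone_hull_expl)

definition SSP :: "'a::real_normed_vector set \<Rightarrow> 'a set \<Rightarrow> bool" where
  "SSP C K \<longleftrightarrow>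
     0 \<notin> closure {x - y | x y. x \<in> convex hull (C \<inter> sphere 0 1) \<and>
                              y \<in> convex hull ((frontier K \<inter> sphere 0 1) \<union> {0})}"

text \<open>\<open>interior_reduction K \<epsilon>\<close> is the set written $K^{-\varepsilon}$.\<close>

definition interior_reduction :: "'a::real_normed_vector set \<Rightarrow> real \<Rightarrow> 'a set" where
  "interior_reduction K \<epsilon> =
     K - (cone_gen {b + \<epsilon> *\<^sub>R u | b u. b \<in> frontier K \<inter> sphere 0 1 \<and> u \<in> ball 0 1} - {0})"

definition inner_approx_seq ::
  "'a::real_normed_vector set \<Rightarrow> (nat \<Rightarrow> 'a set) \<Rightarrow> bool" where
  "inner_approx_seq K Kn \<longleftrightarrow>
     (\<forall>n. nontrivial_cone (Kn n)) \<and>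
     (\<forall>n. Kn n \<subseteq> Kn (Suc n) \<and> Kn (Suc n) \<subseteq> K) \<and>
     (\<forall>\<epsilon>>0. \<exists>m. \<forall>n\<ge>m. interior_reduction K \<epsilon> \<subseteq> Kn n)"

definition closed_inner_approx_seq ::
  "'a::real_normed_vector set \<Rightarrow> (nat \<Rightarrow> 'a set) \<Rightarrow> bool" where
  "closed_inner_approx_seq K Kn \<longleftrightarrow> inner_approx_seq K Kn \<and> (\<forall>n. closed (Kn n))"

end

theory Submission imports Defs begin

text \<open>
  The strict separation property says that the two convex hulls
  \<open>convex hull (C \<inter> sphere 0 1)\<close> and \<open>convex hull ((frontier K \<inter> sphere 0 1) \<union> {0})\<close>
  are at positive distance \<open>\<delta>\<close> from each other (\<open>SSP_iff_uniform_gap\<close>). Only the second hull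
  changes when \<open>K\<close> is replaced by \<open>Kn n\<close>, so it suffices that for large \<open>n\<close> every unit vector in
  the frontier of \<open>Kn n\<close> lies close to a unit vector in the frontier of \<open>K\<close>: closeness of
  generators passes to convex hulls with the same radius (\<open>convex_hull_within_distance\<close>), and the
  gap shrinks by at most that radius.

  That frontiers are close is the point of the interior reduction
  (\<open>frontier_near_frontier\<close>). Let \<open>interior_reduction K \<epsilon> \<subseteq> L \<subseteq> K\<close>, and let \<open>y\<close> be a unit
  vector in the frontier of \<open>L\<close>. Either \<open>y\<close> is already in the frontier of \<open>K\<close>, or it is
  interior to \<open>K\<close>. In the latter case there are points \<open>z\<close> of \<open>K\<close> outside \<open>L\<close> arbitrarily close
  to \<open>y\<close>. Such a \<open>z\<close> has been removed by the interior reduction, so it is a nonnegative multiple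
  of a point at distance less than \<open>\<epsilon>\<close> from some unit vector \<open>b\<close> in the frontier of \<open>K\<close>; as
  \<open>z\<close> is almost a unit vector, the multiple is almost \<open>1\<close>, and \<open>z\<close> itself is within a constant
  times \<open>\<epsilon>\<close> of \<open>b\<close>.
\<close>

lemma SSP_iff_uniform_gap:
  "SSP C K \<longleftrightarrow>
     (\<exists>\<delta>>0. \<forall>x \<in> convex hull (C \<inter> sphere 0 1).
             \<forall>y \<in> convex hull ((frontier K \<inter> sphere 0 1) \<union> {0}). \<delta> \<le> norm (x - y))"
proof -
  let ?D = "{x - y | x y. x \<in> convex hull (C \<inter> sphere 0 1) \<and>
                         y \<in> convex hull ((frontier K \<inter> sphere 0 1) \<union> {0})}"
  have "SSP C K \<longleftrightarrow> (\<exists>\<delta>>0. \<forall>d\<in>?D. \<delta> \<le> norm d)"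
    unfolding SSP_def closure_approachable dist_0_norm dist_norm diff_0_right
    by (simp only: not_all not_imp bex_simps(8) not_less)
  then show ?thesis by blast
qed

text \<open>
  The sum of the convex set \<open>convex hull B\<close> and a ball is convex, so it contains
  \<open>convex hull A\<close> as soon as it contains \<open>A\<close>.
\<close>

lemma convex_hull_within_distance:
  fixes A B :: "'a::real_normed_vector set"
  assumes near: "\<And>a. a \<in> A \<Longrightarrow> \<exists>b\<in>B. norm (a - b) \<le> r"
    and x: "x \<in> convex hull A"
  shows "\<exists>y \<in> convex hull B. norm (x - y) \<le> r"
proof -
  let ?N = "\<Union>b \<in> convex hull B. \<Union>d \<in> cball 0 r. {b + d}"
  have "convex ?N"
    by (intro convex_sums convex_convex_hull convex_cball)
  moreover have "A \<subseteq> ?N"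
  proof
    fix a assume "a \<in> A"
    then obtain b where "b \<in> B" "norm (a - b) \<le> r"
      using near by blast
    then have "b \<in> convex hull B" "a - b \<in> cball 0 r" "a = b + (a - b)"
      by (auto simp: hull_inc)
    then show "a \<in> ?N" by blast
  qed
  ultimately have "x \<in> ?N"
    using x hull_minimal by blast
  then show ?thesis by force
qed

text \<open>
  The scaling factor \<open>c\<close> is controlled by the norms alone: \<open>b + \<epsilon> *\<^sub>R u\<close> has norm
  within \<open>\<epsilon>\<close> of \<open>1\<close>, so \<open>c\<close> differs from \<open>norm z\<close> by at most \<open>c * \<epsilon>\<close>. The bounds \<open>1/2\<close> and
  \<open>3/2\<close> make \<open>c \<le> 3\<close>, whence the constant \<open>6\<close>.
\<close>

lemma scaled_perturbation_near:
  fixes b u z :: "'a::real_normed_vector"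
  assumes b: "norm b = 1" and u: "norm u < 1" and z: "z = c *\<^sub>R (b + \<epsilon> *\<^sub>R u)"
    and c: "0 \<le> c" and \<epsilon>: "0 < \<epsilon>" "\<epsilon> \<le> 1/2" and nz: "norm z \<le> 3/2"
  shows "norm (z - b) \<le> \<bar>norm z - 1\<bar> + 6 * \<epsilon>"
proof -
  have small: "norm (\<epsilon> *\<^sub>R u) \<le> \<epsilon>"
    using u \<epsilon> by (simp add: mult_left_le)
  have nzc: "norm z = c * norm (b + \<epsilon> *\<^sub>R u)"
    using z c by simp
  have near_one: "\<bar>norm (b + \<epsilon> *\<^sub>R u) - 1\<bar> \<le> \<epsilon>"
    using norm_triangle_ineq3[of "b + \<epsilon> *\<^sub>R u" b] b small by simp
  have "norm z - c = c * (norm (b + \<epsilon> *\<^sub>R u) - 1)"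
    by (simp add: nzc right_diff_distrib)
  then have diff: "\<bar>norm z - c\<bar> \<le> c * \<epsilon>"
    using mult_left_mono[OF near_one c] c by (simp add: abs_mult)
  have "c * \<epsilon> \<le> c * (1/2)"
    using c \<epsilon> by (intro mult_left_mono)
  then have "c \<le> 3"
    using diff nz by linarith
  then have c\<epsilon>: "c * \<epsilon> \<le> 3 * \<epsilon>"
    using \<epsilon> by (intro mult_right_mono) auto
  have "z - b = (c - 1) *\<^sub>R b + c *\<^sub>R (\<epsilon> *\<^sub>R u)"
    by (simp add: z algebra_simps)
  then have "norm (z - b) \<le> norm ((c - 1) *\<^sub>R b) + norm (c *\<^sub>R (\<epsilon> *\<^sub>R u))"
    using norm_triangle_ineq by metis
  also have "\<dots> \<le> \<bar>c - 1\<bar> + c * \<epsilon>"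
    using b c mult_left_mono[OF small c] by (simp del: scaleR_scaleR)
  finally show ?thesis
    using diff c\<epsilon> by linarith
qed

lemma frontier_near_frontier:
  fixes K L :: "'a::real_normed_vector set"
  assumes lower: "interior_reduction K \<epsilon> \<subseteq> L" and upper: "L \<subseteq> K"
    and \<epsilon>: "0 < \<epsilon>" "\<epsilon> \<le> 1/2"
    and y: "y \<in> frontier L" "norm y = 1"
  shows "\<exists>b \<in> frontier K \<inter> sphere 0 1. norm (y - b) \<le> 8 * \<epsilon>"
proof (cases "y \<in> interior K")
  case False
  have "y \<in> closure K"
    using y(1) closure_mono[OF upper] by (auto simp: frontier_def)
  then have "y \<in> frontier K \<inter> sphere 0 1"
    using False y(2) by (simp add: frontier_def)
  then show ?thesis
    using \<epsilon> by force
next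
  case True
  have "\<not> interior K \<inter> ball y \<epsilon> \<subseteq> L"
  proof
    assume "interior K \<inter> ball y \<epsilon> \<subseteq> L"
    then have "interior K \<inter> ball y \<epsilon> \<subseteq> interior L"
      by (intro interior_maximal open_Int) auto
    with True \<epsilon> have "y \<in> interior L" by auto
    with y(1) show False by (simp add: frontier_def)
  qed
  then obtain z where "z \<in> interior K" "z \<in> ball y \<epsilon>" "z \<notin> L"
    by blast
  then have yz: "norm (y - z) < \<epsilon>" and "z \<in> K" "z \<notin> L"
    using interior_subset by (auto simp: dist_norm)
  then have "z \<in> cone_gen {b + \<epsilon> *\<^sub>R u | b u. b \<in> frontier K \<inter> sphere 0 1 \<and> u \<in> ball 0 1}"
    using lower by (auto simp: interior_reduction_def)
  then obtain c b u where c: "0 \<le> c" and b: "b \<in> frontier K \<inter> sphere 0 1"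
    and u: "norm u < 1" and z: "z = c *\<^sub>R (b + \<epsilon> *\<^sub>R u)"
    by (auto simp: cone_gen_def)
  have nz: "\<bar>norm z - 1\<bar> \<le> \<epsilon>"
    using norm_triangle_ineq3[of y z] yz y(2) by linarith
  have "norm (z - b) \<le> \<bar>norm z - 1\<bar> + 6 * \<epsilon>"
    using b u z c \<epsilon> nz by (intro scaled_perturbation_near) auto
  then have "norm (y - b) \<le> 8 * \<epsilon>"
    using nz yz norm_triangle_ineq[of "y - z" "z - b"] by simp
  with b show ?thesis by blast
qed

theorem theorem3p13:
  fixes C K :: "'a::real_normed_vector set"
    and Kn :: "nat \<Rightarrow> 'a set"
  assumes "nontrivial_cone C"
    and "nontrivial_cone K"
    and "SSP C K"
    and "closed_inner_approx_seq K Kn"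
  shows "\<exists>n0. \<forall>n\<ge>n0. SSP C (Kn n)"
proof -
  obtain \<delta> where \<delta>: "0 < \<delta>"
    and gap: "\<And>x y. x \<in> convex hull (C \<inter> sphere 0 1) \<Longrightarrow>
        y \<in> convex hull ((frontier K \<inter> sphere 0 1) \<union> {0}) \<Longrightarrow> \<delta> \<le> norm (x - y)"
    using assms(3) unfolding SSP_iff_uniform_gap by blast
  \<comment> \<open>Frontiers will be \<open>8 * \<epsilon>\<close>-close, which this choice makes at most half of the gap.\<close>
  define \<epsilon> where "\<epsilon> = min (1/2) (\<delta>/16)"
  have \<epsilon>: "0 < \<epsilon>" "\<epsilon> \<le> 1/2" "8 * \<epsilon> \<le> \<delta>/2"
    using \<delta> by (auto simp: \<epsilon>_def)
  have approx: "inner_approx_seq K Kn"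
    using assms(4) by (simp add: closed_inner_approx_seq_def)
  then obtain n0 where n0: "\<And>n. n \<ge> n0 \<Longrightarrow> interior_reduction K \<epsilon> \<subseteq> Kn n"
    using \<epsilon>(1) unfolding inner_approx_seq_def by blast
  have "SSP C (Kn n)" if "n \<ge> n0" for n
  proof -
    have sub: "Kn n \<subseteq> K"
      using approx unfolding inner_approx_seq_def by blast
    have near: "\<exists>b \<in> (frontier K \<inter> sphere 0 1) \<union> {0}. norm (a - b) \<le> \<delta>/2"
      if "a \<in> (frontier (Kn n) \<inter> sphere 0 1) \<union> {0}" for a
    proof (cases "a = 0")
      case True
      then show ?thesis using \<delta> by simp
    next
      case False
      then have "a \<in> frontier (Kn n)" "norm a = 1"
        using that by auto
      from frontier_near_frontier[OF n0[OF \<open>n \<ge> n0\<close>] sub \<epsilon>(1,2) this]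
      obtain b where "b \<in> frontier K \<inter> sphere 0 1" "norm (a - b) \<le> 8 * \<epsilon>"
        by blast
      then show ?thesis
        using \<epsilon>(3) by (intro bexI[of _ b]) auto
    qed
    have "\<delta>/2 \<le> norm (x - y)"
      if x: "x \<in> convex hull (C \<inter> sphere 0 1)"
        and y: "y \<in> convex hull ((frontier (Kn n) \<inter> sphere 0 1) \<union> {0})" for x y
    proof -
      obtain w where w: "w \<in> convex hull ((frontier K \<inter> sphere 0 1) \<union> {0})"
        and "norm (y - w) \<le> \<delta>/2"
        using convex_hull_within_distance[OF near y] by blast
      then show ?thesis
        using gap[OF x w] norm_triangle_ineq[of "x - y" "y - w"] by simp
    qed
    then show ?thesis
      unfolding SSP_iff_uniform_gap using \<delta> half_gt_zero by blast
  qed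
  then show ?thesis by blast
qed

end
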